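(* Let $\mathcal W$ be a weak fundamental localizer. Every comma square is $\mathcal W$-exact.
   Context: $\mathrm{Cat}$ is the (2-)category of small categories; $e$ is the terminal category. For a functor $u:A\to B$ and an object $b$ of $B$, $A/b$ is the category of pairs $(a,g:u(a)\to b)$, a morphism $(a_1,g_1)\to(a_2,g_2)$ being an arrow $f:a_1\to a_2$ of $A$ with $g_2u(f)=g_1$. A class $\mathcal W$ of arrows of $\mathrm{Cat}$ is weakly saturated if: identities are in $\mathcal W$; if two of the three arrows of a commutative triangle are in $\mathcal W$, so is the third; if $i:A'\to A$, $r:A\to A'$ satisfy $ri=1_{A'}$ and $ir\in\mathcal W$, then $r\in\mathcal W$. A weak fundamental localizer is a class $\mathcal W$ of arrows of $\mathrm{Cat}$ such that: $\mathcal W$ is weakly saturated; if $A$ has a terminal object, then $A\to e$ is in $\mathcal W$; if $u:A\to B$ is such that for every object $b$ of $B$ the induced functor $A/b\to B/b$ is in $\mathcal W$, then $u\in\mathcal W$. A small category $A$ is $\mathcal W$-aspherical if $A\to e$ is in $\mathcal W$. A square consists of small categories $A,B,A',B'$, functors $v:A'\to A$ (top), $w:B'\to B$ (bottom), $u':A'\to B'$ (left), $u:A\to B$ (right), and a natural transformation $\alpha:uv\to wu'$. It is a comma square if the canonical functor $a'\mapsto (v(a'),u'(a'),\alpha_{a'})$ from $A'$ to the comma category $u\downarrow w$ (objects: triples $(a,b',g:u(a)\to w(b'))$; morphisms $(a_1,b_1',g_1)\to(a_2,b_2',g_2)$: pairs $(f:a_1\to a_2,\ g':b'_1\to b'_2)$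 with $g_2u(f)=w(g')g_1$) is an isomorphism. The square is $\mathcal W$-exact if for all objects $a$ of $A$, $b'$ of $B'$ and every arrow $g:u(a)\to w(b')$ of $B$, the following category $A'_{(a,b',g)}$ is $\mathcal W$-aspherical: objects are triples $(a',f,g')$ with $a'\in\mathrm{Ob}\,A'$, $f:a\to v(a')$ in $A$, $g':u'(a')\to b'$ in $B'$ such that $w(g')\alpha_{a'}u(f)=g$; morphisms $(a'_1,f_1,g'_1)\to(a'_2,f_2,g'_2)$ are arrows $f':a'_1\to a'_2$ of $A'$ with $v(f')f_1=f_2$ and $g'_2u'(f')=g'_1$. *)

theory Defs
  imports "HOL-Library.FuncSet" "HOL-Library.Nat_Bijection"
begin

section \<open>Size\<close>

text \<open>
  HOL has no type of all small categories, so smallness is relative to an ambient type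
  \<open>'u\<close> with an injective pairing and a notion of small subset that is closed under
  subsets, unordered pairs and small-indexed unions. A Grothendieck universe \<open>U\<close> is the case
  \<open>'u = U\<close>, where a subset of \<open>U\<close> is small iff it is an element of \<open>U\<close>; the small
  categories below are then exactly the \<open>U\<close>-small categories. Closure under power sets and the
  existence of an infinite small set are not required, so any infinite type with all its subsets
  small is also allowed.
\<close>

class universe =
  fixes small :: "'a set \<Rightarrow> bool"
    and opair :: "'a \<Rightarrow> 'a \<Rightarrow> 'a"
  assumes small_subset: "small X \<Longrightarrow> Y \<subseteq> X \<Longrightarrow> small Y"
    and small_doubleton: "small {x, y}"
    and small_UNION: "small X \<Longrightarrow> (\<And>x. x \<in> X \<Longrightarrow> small (F x)) \<Longrightarrow> small (\<Union>x\<in>X. F x)"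
    and opair_eq_iff: "opair a b = opair c d \<longleftrightarrow> a = c \<and> b = d"

text \<open>A model of the class axioms: all sets of natural numbers are small.\<close>

instantiation nat :: universe
begin

definition small_nat :: "nat set \<Rightarrow> bool" where "small_nat X \<longleftrightarrow> True"
definition opair_nat :: "nat \<Rightarrow> nat \<Rightarrow> nat" where "opair_nat m n = prod_encode (m, n)"

instance
  by standard (simp_all add: small_nat_def opair_nat_def prod_encode_eq)

end

definition pr1 :: "'u::universe \<Rightarrow> 'u" where
  "pr1 z = (THE x. \<exists>y. z = opair x y)"

definition pr2 :: "'u::universe \<Rightarrow> 'u" where
  "pr2 z = (THE y. \<exists>x. z = opair x y)"

lemma pr_opair [simp]: "pr1 (opair x y) = x" "pr2 (opair x y) = y"
  by (simp_all add: pr1_def pr2_def opair_eq_iff)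

definition otriple :: "'u::universe \<Rightarrow> 'u \<Rightarrow> 'u \<Rightarrow> 'u" where
  "otriple x y z = opair x (opair y z)"

section \<open>Categories, functors and natural transformations\<close>

text \<open>
  \<open>Comp C g f\<close> is \<open>g \<circ> f\<close>. The structure maps take the value \<open>undefined\<close> outside
  their domains, so that equal categories are equal records; likewise for functors.
\<close>

record 'u cat =
  Obj :: "'u set"
  Arr :: "'u set"
  Dom :: "'u \<Rightarrow> 'u"
  Cod :: "'u \<Rightarrow> 'u"
  Idt :: "'u \<Rightarrow> 'u"
  Comp :: "'u \<Rightarrow> 'u \<Rightarrow> 'u"

definition hom :: "'u cat \<Rightarrow> 'u \<Rightarrow> 'u \<Rightarrow> 'u set" where
  "hom C x y = {f \<in> Arr C. Dom C f = x \<and> Cod C f = y}"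

locale category =
  fixes C :: "'u cat"
  assumes Dom_funcset: "Dom C \<in> Arr C \<rightarrow>\<^sub>E Obj C"
    and Cod_funcset: "Cod C \<in> Arr C \<rightarrow>\<^sub>E Obj C"
    and Idt_extensional: "Idt C \<in> extensional (Obj C)"
    and Idt_hom: "x \<in> Obj C \<Longrightarrow> Idt C x \<in> hom C x x"
    and Comp_hom: "f \<in> hom C x y \<Longrightarrow> g \<in> hom C y z \<Longrightarrow> Comp C g f \<in> hom C x z"
    and Comp_undefined:
      "\<not> (f \<in> Arr C \<and> g \<in> Arr C \<and> Cod C f = Dom C g) \<Longrightarrow> Comp C g f = undefined"
    and Comp_Idt_right: "f \<in> hom C x y \<Longrightarrow> Comp C f (Idt C x) = f"
    and Comp_Idt_left: "f \<in> hom C x y \<Longrightarrow> Comp C (Idt C y) f = f"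
    and Comp_assoc: "f \<in> hom C x y \<Longrightarrow> g \<in> hom C y z \<Longrightarrow> h \<in> hom C z t \<Longrightarrow>
      Comp C h (Comp C g f) = Comp C (Comp C h g) f"

definition small_category :: "'u::universe cat \<Rightarrow> bool" where
  "small_category C \<longleftrightarrow> category C \<and> small (Obj C) \<and> small (Arr C)"

definition has_terminal_object :: "'u cat \<Rightarrow> bool" where
  "has_terminal_object C \<longleftrightarrow> (\<exists>t\<in>Obj C. \<forall>x\<in>Obj C. \<exists>!f. f \<in> hom C x t)"

record 'u cfunctor =
  Source :: "'u cat"
  Target :: "'u cat"
  OMap :: "'u \<Rightarrow> 'u"
  AMap :: "'u \<Rightarrow> 'u"

locale is_functor =
  fixes F :: "'u cfunctor"
  assumes Source_category: "category (Source F)"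
    and Target_category: "category (Target F)"
    and OMap_funcset: "OMap F \<in> Obj (Source F) \<rightarrow>\<^sub>E Obj (Target F)"
    and AMap_extensional: "AMap F \<in> extensional (Arr (Source F))"
    and AMap_hom: "f \<in> hom (Source F) x y \<Longrightarrow> AMap F f \<in> hom (Target F) (OMap F x) (OMap F y)"
    and AMap_Idt: "x \<in> Obj (Source F) \<Longrightarrow> AMap F (Idt (Source F) x) = Idt (Target F) (OMap F x)"
    and AMap_Comp: "f \<in> hom (Source F) x y \<Longrightarrow> g \<in> hom (Source F) y z \<Longrightarrow>
      AMap F (Comp (Source F) g f) = Comp (Target F) (AMap F g) (AMap F f)"

definition id_functor :: "'u cat \<Rightarrow> 'u cfunctor" where
  "id_functor C = \<lparr>Source = C, Target = C,
     OMap = restrict (\<lambda>x. x) (Obj C), AMap = restrict (\<lambda>f. f) (Arr C)\<rparr>"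

definition comp_functor :: "'u cfunctor \<Rightarrow> 'u cfunctor \<Rightarrow> 'u cfunctor" where
  "comp_functor G F = \<lparr>Source = Source F, Target = Target G,
     OMap = compose (Obj (Source F)) (OMap G) (OMap F),
     AMap = compose (Arr (Source F)) (AMap G) (AMap F)\<rparr>"

definition is_iso_functor :: "'u cfunctor \<Rightarrow> bool" where
  "is_iso_functor F \<longleftrightarrow> is_functor F \<and>
     (\<exists>G. is_functor G \<and> Source G = Target F \<and> Target G = Source F \<and>
       comp_functor G F = id_functor (Source F) \<and> comp_functor F G = id_functor (Target F))"

locale nat_trans =
  fixes F G :: "'u cfunctor" and \<alpha> :: "'u \<Rightarrow> 'u"
  assumes F_functor: "is_functor F"
    and G_functor: "is_functor G"
    and Source_eq: "Source F = Source G"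
    and Target_eq: "Target F = Target G"
    and component_hom: "x \<in> Obj (Source F) \<Longrightarrow> \<alpha> x \<in> hom (Target F) (OMap F x) (OMap G x)"
    and naturality: "f \<in> hom (Source F) x y \<Longrightarrow>
      Comp (Target F) (\<alpha> y) (AMap F f) = Comp (Target F) (AMap G f) (\<alpha> x)"

definition Cat_arrows :: "'u::universe cfunctor set" where
  "Cat_arrows = {F. is_functor F \<and> small_category (Source F) \<and> small_category (Target F)}"

text \<open>A terminal category \<open>e\<close>; the choice of its unique object is immaterial.\<close>

definition terminal_cat :: "'u cat" where
  "terminal_cat = \<lparr>Obj = {undefined}, Arr = {undefined}, Dom = (\<lambda>_. undefined),
     Cod = (\<lambda>_. undefined), Idt = (\<lambda>_. undefined), Comp = (\<lambda>_ _. undefined)\<rparr>"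

definition to_terminal :: "'u cat \<Rightarrow> 'u cfunctor" where
  "to_terminal A = \<lparr>Source = A, Target = terminal_cat,
     OMap = (\<lambda>_. undefined), AMap = (\<lambda>_. undefined)\<rparr>"

section \<open>Slices, comma categories and the categories of \<open>\<W>\<close>-exactness\<close>

text \<open>
  In each of these categories a morphism from \<open>x\<close> to \<open>y\<close> is an element of a set \<open>H x y\<close>,
  and the same element may be a morphism between several pairs of objects. The arrows
  of \<open>cat_of_homs X H i c\<close> are therefore the triples \<open>(x, f, y)\<close> with \<open>f \<in> H x y\<close>;
  \<open>i x\<close> is the identity of \<open>x\<close> and \<open>c g f\<close> is \<open>g \<circ> f\<close>.
\<close>

definition cat_of_homs ::
    "'u::universe set \<Rightarrow> ('u \<Rightarrow> 'u \<Rightarrow> 'u set) \<Rightarrow> ('u \<Rightarrow> 'u) \<Rightarrow> ('u \<Rightarrow> 'u \<Rightarrow> 'u) \<Rightarrow> 'u cat" where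
  "cat_of_homs X H i c =
     (let M = {otriple x f y | x f y. x \<in> X \<and> y \<in> X \<and> f \<in> H x y};
          src = (\<lambda>m. pr1 m); arr = (\<lambda>m. pr1 (pr2 m)); tgt = (\<lambda>m. pr2 (pr2 m))
      in \<lparr>Obj = X, Arr = M,
          Dom = restrict src M,
          Cod = restrict tgt M,
          Idt = restrict (\<lambda>x. otriple x (i x) x) X,
          Comp = (\<lambda>n m. if m \<in> M \<and> n \<in> M \<and> tgt m = src n
                        then otriple (src m) (c (arr n) (arr m)) (tgt n) else undefined)\<rparr>)"

text \<open>\<open>A/b\<close> for \<open>u : A \<rightarrow> B\<close>, with objects the pairs \<open>(a, g : u(a) \<rightarrow> b)\<close>.\<close>

definition slice_cat :: "'u::universe cfunctor \<Rightarrow> 'u \<Rightarrow> 'u cat" where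
  "slice_cat u b = (let A = Source u; B = Target u in
     cat_of_homs
       {opair a g | a g. a \<in> Obj A \<and> g \<in> hom B (OMap u a) b}
       (\<lambda>x y. {f \<in> hom A (pr1 x) (pr1 y). Comp B (pr2 y) (AMap u f) = pr2 x})
       (\<lambda>x. Idt A (pr1 x))
       (Comp A))"

text \<open>The functor \<open>A/b \<rightarrow> B/b\<close> induced by \<open>u : A \<rightarrow> B\<close>, sending \<open>(a, g)\<close> to
  \<open>(u(a), g)\<close> and \<open>f\<close> to \<open>u(f)\<close>.\<close>

definition slice_functor :: "'u::universe cfunctor \<Rightarrow> 'u \<Rightarrow> 'u cfunctor" where
  "slice_functor u b =
     (let ob = (\<lambda>x. opair (OMap u (pr1 x)) (pr2 x)) in
      \<lparr>Source = slice_cat u b, Target = slice_cat (id_functor (Target u)) b,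
       OMap = restrict ob (Obj (slice_cat u b)),
       AMap = restrict
         (\<lambda>m. otriple (ob (pr1 m)) (AMap u (pr1 (pr2 m))) (ob (pr2 (pr2 m))))
         (Arr (slice_cat u b))\<rparr>)"

text \<open>\<open>u \<down> w\<close> for \<open>u : A \<rightarrow> B\<close> and \<open>w : B' \<rightarrow> B\<close>, with objects the triples
  \<open>(a, b', g : u(a) \<rightarrow> w(b'))\<close> and morphisms the pairs \<open>(f, g')\<close>.\<close>

definition comma_cat :: "'u::universe cfunctor \<Rightarrow> 'u cfunctor \<Rightarrow> 'u cat" where
  "comma_cat u w = (let A = Source u; B = Target u; B' = Source w in
     cat_of_homs
       {otriple a b' g | a b' g. a \<in> Obj A \<and> b' \<in> Obj B' \<and> g \<in> hom B (OMap u a) (OMap w b')}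
       (\<lambda>x y. {opair f g' | f g'.
          f \<in> hom A (pr1 x) (pr1 y) \<and> g' \<in> hom B' (pr1 (pr2 x)) (pr1 (pr2 y)) \<and>
          Comp B (pr2 (pr2 y)) (AMap u f) = Comp B (AMap w g') (pr2 (pr2 x))})
       (\<lambda>x. opair (Idt A (pr1 x)) (Idt B' (pr1 (pr2 x))))
       (\<lambda>q p. opair (Comp A (pr1 q) (pr1 p)) (Comp B' (pr2 q) (pr2 p))))"

section \<open>Weak fundamental localizers\<close>

definition weakly_saturated :: "'u::universe cfunctor set \<Rightarrow> bool" where
  "weakly_saturated W \<longleftrightarrow>
     W \<subseteq> Cat_arrows \<and>
     (\<forall>A. small_category A \<longrightarrow> id_functor A \<in> W) \<and>
     (\<forall>F\<in>Cat_arrows. \<forall>G\<in>Cat_arrows. Target F = Source G \<longrightarrow>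
        (F \<in> W \<and> G \<in> W \<longrightarrow> comp_functor G F \<in> W) \<and>
        (F \<in> W \<and> comp_functor G F \<in> W \<longrightarrow> G \<in> W) \<and>
        (G \<in> W \<and> comp_functor G F \<in> W \<longrightarrow> F \<in> W)) \<and>
     (\<forall>i\<in>Cat_arrows. \<forall>r\<in>Cat_arrows. Target i = Source r \<and> Target r = Source i \<and>
        comp_functor r i = id_functor (Source i) \<and> comp_functor i r \<in> W \<longrightarrow> r \<in> W)"

definition weak_fundamental_localizer :: "'u::universe cfunctor set \<Rightarrow> bool" where
  "weak_fundamental_localizer W \<longleftrightarrow>
     weakly_saturated W \<and>
     (\<forall>A. small_category A \<and> has_terminal_object A \<longrightarrow> to_terminal A \<in> W) \<and>
     (\<forall>u\<in>Cat_arrows. (\<forall>b\<in>Obj (Target u). slice_functor u b \<in> W) \<longrightarrow> u \<in> W)"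

definition aspherical :: "'u::universe cfunctor set \<Rightarrow> 'u cat \<Rightarrow> bool" where
  "aspherical W A \<longleftrightarrow> small_category A \<and> to_terminal A \<in> W"

section \<open>Squares\<close>

text \<open>
  The arguments \<open>v w u' u \<alpha>\<close> are the top \<open>v : A' \<rightarrow> A\<close>, the bottom \<open>w : B' \<rightarrow> B\<close>, the left
  side \<open>u' : A' \<rightarrow> B'\<close>, the right side \<open>u : A \<rightarrow> B\<close> and the 2-cell \<open>\<alpha> : u v \<Rightarrow> w u'\<close>.
\<close>

definition square ::
    "'u::universe cfunctor \<Rightarrow> 'u cfunctor \<Rightarrow> 'u cfunctor \<Rightarrow> 'u cfunctor \<Rightarrow> ('u \<Rightarrow> 'u) \<Rightarrow> bool" where
  "square v w u' u \<alpha> \<longleftrightarrow>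
     v \<in> Cat_arrows \<and> w \<in> Cat_arrows \<and> u' \<in> Cat_arrows \<and> u \<in> Cat_arrows \<and>
     Source v = Source u' \<and> Target v = Source u \<and> Target u' = Source w \<and> Target u = Target w \<and>
     nat_trans (comp_functor u v) (comp_functor w u') \<alpha>"

definition comma_comparison ::
    "'u::universe cfunctor \<Rightarrow> 'u cfunctor \<Rightarrow> 'u cfunctor \<Rightarrow> 'u cfunctor \<Rightarrow> ('u \<Rightarrow> 'u) \<Rightarrow> 'u cfunctor" where
  "comma_comparison v w u' u \<alpha> =
     (let A' = Source v; ob = (\<lambda>a'. otriple (OMap v a') (OMap u' a') (\<alpha> a')) in
      \<lparr>Source = A', Target = comma_cat u w,
       OMap = restrict ob (Obj A'),
       AMap = restrict
         (\<lambda>f'. otriple (ob (Dom A' f')) (opair (AMap v f') (AMap u' f')) (ob (Cod A' f')))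
         (Arr A')\<rparr>)"

definition comma_square ::
    "'u::universe cfunctor \<Rightarrow> 'u cfunctor \<Rightarrow> 'u cfunctor \<Rightarrow> 'u cfunctor \<Rightarrow> ('u \<Rightarrow> 'u) \<Rightarrow> bool" where
  "comma_square v w u' u \<alpha> \<longleftrightarrow>
     square v w u' u \<alpha> \<and> is_iso_functor (comma_comparison v w u' u \<alpha>)"

text \<open>\<open>A'\<^bsub>(a, b', g)\<^esub>\<close>, with objects the triples
  \<open>(a', f : a \<rightarrow> v(a'), g' : u'(a') \<rightarrow> b')\<close> such that \<open>w(g') \<alpha>\<^bsub>a'\<^esub> u(f) = g\<close>.\<close>

definition factorization_cat ::
    "'u::universe cfunctor \<Rightarrow> 'u cfunctor \<Rightarrow> 'u cfunctor \<Rightarrow> 'u cfunctor \<Rightarrow> ('u \<Rightarrow> 'u) \<Rightarrow>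
     'u \<Rightarrow> 'u \<Rightarrow> 'u \<Rightarrow> 'u cat" where
  "factorization_cat v w u' u \<alpha> a b' g =
     (let A' = Source v; A = Source u; B' = Source w; B = Target u in
     cat_of_homs
       {otriple a' f g' | a' f g'.
          a' \<in> Obj A' \<and> f \<in> hom A a (OMap v a') \<and> g' \<in> hom B' (OMap u' a') b' \<and>
          Comp B (AMap w g') (Comp B (\<alpha> a') (AMap u f)) = g}
       (\<lambda>x y. {f' \<in> hom A' (pr1 x) (pr1 y).
          Comp A (AMap v f') (pr1 (pr2 x)) = pr1 (pr2 y) \<and>
          Comp B' (pr2 (pr2 y)) (AMap u' f') = pr2 (pr2 x)})
       (\<lambda>x. Idt A' (pr1 x))
       (Comp A'))"

definition exact_square ::
    "'u::universe cfunctor set \<Rightarrow>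
     'u cfunctor \<Rightarrow> 'u cfunctor \<Rightarrow> 'u cfunctor \<Rightarrow> 'u cfunctor \<Rightarrow> ('u \<Rightarrow> 'u) \<Rightarrow> bool" where
  "exact_square W v w u' u \<alpha> \<longleftrightarrow>
     square v w u' u \<alpha> \<and>
     (\<forall>a\<in>Obj (Source u). \<forall>b'\<in>Obj (Source w).
        \<forall>g\<in>hom (Target u) (OMap u a) (OMap w b').
          aspherical W (factorization_cat v w u' u \<alpha> a b' g))"

end

theory Submission
  imports Defs
begin

text \<open>
  Identify \<open>A'\<close> with \<open>u \<down> w\<close>. For \<open>g : u(a) \<rightarrow> w(b')\<close>, let \<open>K\<^sub>0\<close> be the category of
  pairs \<open>(f : a \<rightarrow> a\<^sub>1, h : u(a\<^sub>1) \<rightarrow> w(b'))\<close> with \<open>h u(f) = g\<close>. The functor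
  \<open>A'\<^bsub>(a, b', g)\<^esub> \<rightarrow> K\<^sub>0\<close> sending \<open>(a', f, g')\<close> to \<open>(f, w(g') \<alpha>\<^bsub>a'\<^esub>)\<close> has the right
  adjoint \<open>(f, h) \<mapsto> ((a\<^sub>1, b', h), f, 1)\<close>, and \<open>e \<rightarrow> K\<^sub>0\<close> with value the initial object
  \<open>(1\<^sub>a, g)\<close> has a right adjoint as well. The slices of a functor that has a right adjoint
  have terminal objects, so both functors belong to \<open>\<W>\<close>.
\<close>

section \<open>Small sets\<close>

lemma small_singleton: "small {x :: 'u::universe}"
  using small_doubleton[of x x] by simp

lemma small_opair:
  fixes X Y :: "'u::universe set"
  assumes "small X" "small Y"
  shows "small {opair x y | x y. x \<in> X \<and> y \<in> Y}"
proof -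
  have "{opair x y | x y. x \<in> X \<and> y \<in> Y} = (\<Union>x\<in>X. \<Union>y\<in>Y. {opair x y})"
    by blast
  then show ?thesis
    using assms by (simp add: small_UNION small_singleton)
qed

lemma small_otriple:
  fixes X Y Z :: "'u::universe set"
  assumes "small X" "small Y" "small Z"
  shows "small {otriple x y z | x y z. x \<in> X \<and> y \<in> Y \<and> z \<in> Z}"
proof -
  have "{otriple x y z | x y z. x \<in> X \<and> y \<in> Y \<and> z \<in> Z}
      = {opair x p | x p. x \<in> X \<and> p \<in> {opair y z | y z. y \<in> Y \<and> z \<in> Z}}"
    unfolding otriple_def by blast
  then show ?thesis
    using assms by (simp only: small_opair)
qed

lemma otriple_eq_iff: "otriple a b c = otriple x y z \<longleftrightarrow> a = x \<and> b = y \<and> c = z"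
  by (simp add: otriple_def opair_eq_iff)

lemma pr_otriple [simp]:
  "pr1 (otriple x y z) = x" "pr1 (pr2 (otriple x y z)) = y" "pr2 (pr2 (otriple x y z)) = z"
  by (simp_all add: otriple_def)

section \<open>Categories given by hom-sets\<close>

lemma (in category) hom_Obj:
  assumes "f \<in> hom C x y"
  shows "x \<in> Obj C" "y \<in> Obj C"
  using assms Dom_funcset Cod_funcset by (auto simp: hom_def)

lemma (in is_functor) OMap_Obj: "x \<in> Obj (Source F) \<Longrightarrow> OMap F x \<in> Obj (Target F)"
  using OMap_funcset by auto

lemma hom_Arr: "f \<in> hom C x y \<Longrightarrow> f \<in> Arr C"
  by (simp add: hom_def)

text \<open>Slices, comma categories and factorization categories are all built by
  \<open>cat_of_homs\<close>. The axioms here concern the untagged arrows in \<open>H x y\<close>.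
  The tags for source and target are dealt with once, inside this locale.\<close>

locale homs_category =
  fixes X :: "'u::universe set" and H :: "'u \<Rightarrow> 'u \<Rightarrow> 'u set"
    and i :: "'u \<Rightarrow> 'u" and c :: "'u \<Rightarrow> 'u \<Rightarrow> 'u"
  assumes ident: "x \<in> X \<Longrightarrow> i x \<in> H x x"
    and comp: "\<lbrakk>x \<in> X; y \<in> X; z \<in> X; f \<in> H x y; g \<in> H y z\<rbrakk> \<Longrightarrow> c g f \<in> H x z"
    and ident_right: "\<lbrakk>x \<in> X; y \<in> X; f \<in> H x y\<rbrakk> \<Longrightarrow> c f (i x) = f"
    and ident_left: "\<lbrakk>x \<in> X; y \<in> X; f \<in> H x y\<rbrakk> \<Longrightarrow> c (i y) f = f"
    and assoc: "\<lbrakk>x \<in> X; y \<in> X; z \<in> X; t \<in> X; f \<in> H x y; g \<in> H y z; h \<in> H z t\<rbrakk>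
      \<Longrightarrow> c h (c g f) = c (c h g) f"
begin

abbreviation "CH \<equiv> cat_of_homs X H i c"

lemma Obj_CH: "Obj CH = X"
  by (simp add: cat_of_homs_def Let_def)

lemma Arr_CH: "Arr CH = {otriple x f y | x f y. x \<in> X \<and> y \<in> X \<and> f \<in> H x y}"
  by (simp add: cat_of_homs_def Let_def)

lemma Idt_CH: "x \<in> X \<Longrightarrow> Idt CH x = otriple x (i x) x"
  by (simp add: cat_of_homs_def Let_def)

lemma hom_CH:
  "m \<in> hom CH x y \<longleftrightarrow> x \<in> X \<and> y \<in> X \<and> (\<exists>f\<in>H x y. m = otriple x f y)"
  by (auto simp: hom_def cat_of_homs_def Let_def otriple_eq_iff)

lemma Comp_CH:
  assumes "x \<in> X" "y \<in> X" "z \<in> X" "f \<in> H x y" "g \<in> H y z"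
  shows "Comp CH (otriple y g z) (otriple x f y) = otriple x (c g f) z"
  using assms by (auto simp: cat_of_homs_def Let_def otriple_eq_iff)

lemma category_CH: "category CH"
proof
  show "Dom CH \<in> Arr CH \<rightarrow>\<^sub>E Obj CH" "Cod CH \<in> Arr CH \<rightarrow>\<^sub>E Obj CH"
    "Idt CH \<in> extensional (Obj CH)"
    by (auto simp: cat_of_homs_def Let_def)
next
  fix x assume "x \<in> Obj CH"
  then show "Idt CH x \<in> hom CH x x"
    using ident by (auto simp: Obj_CH Idt_CH hom_CH)
next
  fix f g x y z assume "f \<in> hom CH x y" "g \<in> hom CH y z"
  then show "Comp CH g f \<in> hom CH x z"
    by (auto simp: hom_CH Comp_CH comp)
next
  fix f g assume "\<not> (f \<in> Arr CH \<and> g \<in> Arr CH \<and> Cod CH f = Dom CH g)"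
  then show "Comp CH g f = undefined"
    by (auto simp: cat_of_homs_def Let_def otriple_eq_iff)
next
  fix f x y assume "f \<in> hom CH x y"
  then show "Comp CH f (Idt CH x) = f" "Comp CH (Idt CH y) f = f"
    by (auto simp: hom_CH Idt_CH Comp_CH ident ident_right ident_left)
next
  fix f g h x y z t assume "f \<in> hom CH x y" "g \<in> hom CH y z" "h \<in> hom CH z t"
  then obtain f' g' h' where
    "x \<in> X" "y \<in> X" "z \<in> X" "t \<in> X" "f' \<in> H x y" "g' \<in> H y z" "h' \<in> H z t"
    "f = otriple x f' y" "g = otriple y g' z" "h = otriple z h' t"
    by (auto simp: hom_CH)
  then show "Comp CH h (Comp CH g f) = Comp CH (Comp CH h g) f"
    by (simp add: Comp_CH comp assoc)
qed

text \<open>One small set \<open>F\<close> containing every \<open>H x y\<close> is enough, because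
  an arrow is a triple from \<open>X\<close>, \<open>F\<close> and \<open>X\<close>. In the
  applications \<open>F\<close> is the set of all arrows of the category from which the untagged
  arrows are taken.\<close>

lemma small_category_CH:
  assumes "small X" "small F" "\<And>x y. x \<in> X \<Longrightarrow> y \<in> X \<Longrightarrow> H x y \<subseteq> F"
  shows "small_category CH"
proof -
  have "Arr CH \<subseteq> {otriple x f y | x f y. x \<in> X \<and> f \<in> F \<and> y \<in> X}"
    using assms(3) by (fastforce simp: Arr_CH)
  then have "small (Arr CH)"
    using small_otriple[OF assms(1,2,1)] small_subset by blast
  then show ?thesis
    using assms(1) by (simp add: small_category_def category_CH Obj_CH)
qed

lemma terminal_CH:
  assumes "t \<in> X" "\<And>x. x \<in> X \<Longrightarrow> \<exists>!f. f \<in> H x t"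
  shows "has_terminal_object CH"
  unfolding has_terminal_object_def
proof (rule bexI[of _ t], rule ballI)
  show "t \<in> Obj CH"
    using assms(1) by (simp add: Obj_CH)
  fix x assume "x \<in> Obj CH"
  then have x: "x \<in> X"
    by (simp add: Obj_CH)
  from assms(2)[OF x] show "\<exists>!f. f \<in> hom CH x t"
    using x assms(1) by (auto simp: hom_CH)
qed

end

text \<open>The common shape of \<open>slice_functor\<close> and of the functor to
  \<open>K\<^sub>0\<close>: \<open>ar\<close> sees the untagged arrow alone, and the tags follow
  \<open>ob\<close>.\<close>

definition functor_of_homs ::
    "'u::universe cat \<Rightarrow> 'u cat \<Rightarrow> ('u \<Rightarrow> 'u) \<Rightarrow> ('u \<Rightarrow> 'u) \<Rightarrow> 'u cfunctor" where
  "functor_of_homs C D ob ar = \<lparr>Source = C, Target = D, OMap = restrict ob (Obj C),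
     AMap = restrict
       (\<lambda>m. otriple (ob (pr1 m)) (ar (pr1 (pr2 m))) (ob (pr2 (pr2 m)))) (Arr C)\<rparr>"

lemma functor_of_homs_sel [simp]:
  "Source (functor_of_homs C D ob ar) = C"
  "Target (functor_of_homs C D ob ar) = D"
  "OMap (functor_of_homs C D ob ar) = restrict ob (Obj C)"
  by (simp_all add: functor_of_homs_def)

lemma is_functor_functor_of_homs:
  assumes "homs_category X H i c" "homs_category X' H' i' c'"
    and ob: "\<And>x. x \<in> X \<Longrightarrow> ob x \<in> X'"
    and ar: "\<And>x y f. \<lbrakk>x \<in> X; y \<in> X; f \<in> H x y\<rbrakk> \<Longrightarrow> ar f \<in> H' (ob x) (ob y)"
    and ar_ident: "\<And>x. x \<in> X \<Longrightarrow> ar (i x) = i' (ob x)"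
    and ar_comp: "\<And>x y z f g. \<lbrakk>x \<in> X; y \<in> X; z \<in> X; f \<in> H x y; g \<in> H y z\<rbrakk>
      \<Longrightarrow> ar (c g f) = c' (ar g) (ar f)"
  shows "is_functor (functor_of_homs (cat_of_homs X H i c) (cat_of_homs X' H' i' c') ob ar)"
    (is "is_functor ?F")
proof -
  interpret S: homs_category X H i c by fact
  interpret T: homs_category X' H' i' c' by fact
  have AMap: "AMap ?F (otriple x f y) = otriple (ob x) (ar f) (ob y)"
    if "x \<in> X" "y \<in> X" "f \<in> H x y" for x y f
    using that by (auto simp: functor_of_homs_def S.Arr_CH otriple_eq_iff)
  show ?thesis
  proof (rule is_functor.intro)
    show "category (Source ?F)" "category (Target ?F)"
      by (simp_all add: S.category_CH T.category_CH)
    show "OMap ?F \<in> Obj (Source ?F) \<rightarrow>\<^sub>E Obj (Target ?F)"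
      by (auto simp: S.Obj_CH T.Obj_CH ob)
    show "AMap ?F \<in> extensional (Arr (Source ?F))"
      by (simp add: functor_of_homs_def)
  next
    fix f x y assume "f \<in> hom (Source ?F) x y"
    then show "AMap ?F f \<in> hom (Target ?F) (OMap ?F x) (OMap ?F y)"
      by (auto simp: S.hom_CH T.hom_CH S.Obj_CH AMap ob ar)
  next
    fix x assume "x \<in> Obj (Source ?F)"
    then show "AMap ?F (Idt (Source ?F) x) = Idt (Target ?F) (OMap ?F x)"
      by (simp add: S.Obj_CH S.Idt_CH T.Idt_CH S.ident AMap ob ar_ident)
  next
    fix f g x y z assume "f \<in> hom (Source ?F) x y" "g \<in> hom (Source ?F) y z"
    then obtain f' g' where "x \<in> X" "y \<in> X" "z \<in> X" "f' \<in> H x y" "g' \<in> H y z"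
      "f = otriple x f' y" "g = otriple y g' z"
      by (auto simp: S.hom_CH)
    then show "AMap ?F (Comp (Source ?F) g f) = Comp (Target ?F) (AMap ?F g) (AMap ?F f)"
      by (simp add: S.Comp_CH T.Comp_CH AMap S.comp ob ar ar_comp)
  qed
qed

section \<open>Terminal category and identity functors\<close>

lemma category_terminal_cat: "category terminal_cat"
  by standard (auto simp: terminal_cat_def hom_def)

lemma small_category_terminal_cat: "small_category (terminal_cat :: 'u::universe cat)"
  by (simp add: small_category_def category_terminal_cat)
    (simp add: terminal_cat_def small_singleton)

lemma is_functor_to_terminal:
  assumes "category A"
  shows "is_functor (to_terminal A)"
  using assms category_terminal_cat
  by (intro is_functor.intro) (auto simp: to_terminal_def terminal_cat_def hom_def extensional_def)

lemma to_terminal_Cat_arrows: "small_category A \<Longrightarrow> to_terminal A \<in> Cat_arrows"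
  using small_category_terminal_cat
  by (auto simp: Cat_arrows_def small_category_def is_functor_to_terminal)
    (auto simp: to_terminal_def)

lemma is_functor_id_functor:
  assumes "category A"
  shows "is_functor (id_functor A)"
proof -
  interpret category A by fact
  show ?thesis
    using assms
    by (intro is_functor.intro)
      (auto simp: id_functor_def hom_Obj hom_Arr hom_Arr[OF Idt_hom] hom_Arr[OF Comp_hom])
qed

text \<open>The two records are strictly equal: the only object and the only arrow of
  \<open>terminal_cat\<close> are \<open>undefined\<close>, which is also the value of
  \<open>compose\<close> outside its domain.\<close>

lemma comp_to_terminal:
  assumes "is_functor F" "Target F = B"
  shows "comp_functor (to_terminal B) F = to_terminal (Source F)"
  by (auto simp: comp_functor_def to_terminal_def compose_def restrict_def)

section \<open>Slices\<close>

lemma slice_homs_category: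
  assumes "is_functor u"
  shows "homs_category
       {opair a g | a g. a \<in> Obj (Source u) \<and> g \<in> hom (Target u) (OMap u a) b}
       (\<lambda>x y. {f \<in> hom (Source u) (pr1 x) (pr1 y).
         Comp (Target u) (pr2 y) (AMap u f) = pr2 x})
       (\<lambda>x. Idt (Source u) (pr1 x)) (Comp (Source u))"
proof -
  interpret is_functor u by fact
  interpret A: category "Source u" by (rule Source_category)
  interpret B: category "Target u" by (rule Target_category)
  show ?thesis
    by standard
      (auto simp: A.Idt_hom A.Comp_hom A.Comp_Idt_right A.Comp_Idt_left A.Comp_assoc
        AMap_Idt B.Comp_Idt_right AMap_Comp B.Comp_assoc[OF AMap_hom AMap_hom])
qed

lemma small_category_slice_cat:
  assumes "u \<in> Cat_arrows"
  shows "small_category (slice_cat u b)"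
proof -
  have u: "is_functor u" "small_category (Source u)" "small_category (Target u)"
    using assms by (auto simp: Cat_arrows_def)
  interpret S: homs_category
    "{opair a g | a g. a \<in> Obj (Source u) \<and> g \<in> hom (Target u) (OMap u a) b}"
    "\<lambda>x y. {f \<in> hom (Source u) (pr1 x) (pr1 y).
       Comp (Target u) (pr2 y) (AMap u f) = pr2 x}"
    "\<lambda>x. Idt (Source u) (pr1 x)" "Comp (Source u)"
    by (rule slice_homs_category[OF u(1)])
  have "small {opair a g | a g. a \<in> Obj (Source u) \<and> g \<in> Arr (Target u)}"
    using u by (simp add: small_category_def small_opair)
  then have "small {opair a g | a g. a \<in> Obj (Source u) \<and> g \<in> hom (Target u) (OMap u a) b}"
    by (rule small_subset) (auto dest: hom_Arr)
  then show ?thesis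
    unfolding slice_cat_def Let_def
    by (rule S.small_category_CH[where F = "Arr (Source u)"])
      (use u in \<open>auto simp: small_category_def dest: hom_Arr\<close>)
qed

text \<open>Two out of three is available for members of \<open>Cat_arrows\<close> only, so this has
  to be known before \<open>slice_functor u b\<close> can be shown to lie in
  \<open>W\<close>.\<close>

lemma slice_functor_Cat_arrows:
  assumes "u \<in> Cat_arrows"
  shows "slice_functor u b \<in> Cat_arrows"
proof -
  have u: "is_functor u" "small_category (Source u)" "small_category (Target u)"
    using assms by (auto simp: Cat_arrows_def)
  interpret is_functor u by fact
  interpret B: category "Target u" by (rule Target_category)
  \<comment> \<open>\<open>B/b\<close> is encoded as a slice of the identity functor, so the facts
    about slices apply to the target too.\<close>
  let ?I = "id_functor (Target u)"
  have I: "is_functor ?I"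
    by (rule is_functor_id_functor) (rule Target_category)
  have I': "?I \<in> Cat_arrows"
    using I u by (simp add: Cat_arrows_def) (simp add: id_functor_def)
  have "slice_functor u b = functor_of_homs (slice_cat u b) (slice_cat ?I b)
      (\<lambda>x. opair (OMap u (pr1 x)) (pr2 x)) (AMap u)"
    by (simp add: slice_functor_def functor_of_homs_def Let_def)
  moreover have "is_functor \<dots>"
    unfolding slice_cat_def Let_def
    by (rule is_functor_functor_of_homs[OF slice_homs_category[OF u(1)] slice_homs_category[OF I]])
      (auto simp: id_functor_def AMap_hom OMap_Obj AMap_Idt AMap_Comp hom_Arr[OF AMap_hom]
        opair_eq_iff)
  ultimately show ?thesis
    using small_category_slice_cat[OF assms] small_category_slice_cat[OF I']
    by (simp add: Cat_arrows_def)
qed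

text \<open>The terminal object is (b, 1): an arrow to it from (x, g) is an f with 1 f = g, hence g
  itself.\<close>

lemma terminal_slice_cat_id:
  assumes "category B" "b \<in> Obj B"
  shows "has_terminal_object (slice_cat (id_functor B) b)"
proof -
  interpret B: category B by fact
  have I: "is_functor (id_functor B)"
    using assms(1) by (rule is_functor_id_functor)
  show ?thesis
    unfolding slice_cat_def Let_def
    by (rule homs_category.terminal_CH[OF slice_homs_category[OF I], where t = "opair b (Idt B b)"])
      (use assms in \<open>auto simp: id_functor_def B.Idt_hom B.Comp_Idt_left hom_Arr opair_eq_iff\<close>)
qed

section \<open>Asphericity\<close>

lemma weak_fundamental_localizer_2_of_3:
  assumes "weak_fundamental_localizer W" "F \<in> Cat_arrows" "G \<in> Cat_arrows"
    and "Target F = Source G"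
  shows "F \<in> W \<Longrightarrow> G \<in> W \<Longrightarrow> comp_functor G F \<in> W"
    and "F \<in> W \<Longrightarrow> comp_functor G F \<in> W \<Longrightarrow> G \<in> W"
    and "G \<in> W \<Longrightarrow> comp_functor G F \<in> W \<Longrightarrow> F \<in> W"
  using assms unfolding weak_fundamental_localizer_def weakly_saturated_def by blast+

text \<open>The last hypothesis says that \<open>F\<close> has a right adjoint.\<close>

lemma terminal_slices_in_localizer:
  assumes W: "weak_fundamental_localizer W" and F: "F \<in> Cat_arrows"
    and tm: "\<And>b. b \<in> Obj (Target F) \<Longrightarrow> has_terminal_object (slice_cat F b)"
  shows "F \<in> W"
proof -
  \<comment> \<open>Source and target of the slice functor both have a terminal object, so both map
    to \<open>e\<close> by arrows of \<open>W\<close>. These two arrows and the slice functor form a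
    commutative triangle, and two out of three applies.\<close>
  have "slice_functor F b \<in> W" if b: "b \<in> Obj (Target F)" for b
  proof -
    let ?S = "slice_functor F b" and ?D = "slice_cat (id_functor (Target F)) b"
    have sel: "Source ?S = slice_cat F b" "Target ?S = ?D"
      by (simp_all add: slice_functor_def Let_def)
    have S: "?S \<in> Cat_arrows"
      by (rule slice_functor_Cat_arrows[OF F])
    have D: "small_category ?D" "is_functor ?S"
      using S sel by (auto simp: Cat_arrows_def)
    have "category (Target F)"
      using F by (simp add: Cat_arrows_def small_category_def)
    then have "to_terminal ?D \<in> W"
      using W D(1) terminal_slice_cat_id[OF _ b] by (simp add: weak_fundamental_localizer_def)
    moreover have "to_terminal (slice_cat F b) \<in> W"
      using W tm[OF b] small_category_slice_cat[OF F] by (simp add: weak_fundamental_localizer_def)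
    ultimately show ?thesis
      using weak_fundamental_localizer_2_of_3(3)[OF W S to_terminal_Cat_arrows[OF D(1)]] sel
        comp_to_terminal[OF D(2) sel(2)]
      by (simp add: to_terminal_def)
  qed
  then show ?thesis
    using W F by (simp add: weak_fundamental_localizer_def)
qed

text \<open>The axioms speak of terminal objects. To pass to an initial object \<open>z\<close>, use
  the functor from \<open>e\<close> to \<open>K\<close> with value \<open>z\<close>: it lies in
  \<open>W\<close> by its slices, and so does its composite with the functor from \<open>K\<close>
  to \<open>e\<close>, which is the identity of \<open>e\<close>.\<close>

lemma aspherical_initial_object:
  assumes W: "weak_fundamental_localizer W" and K: "small_category K"
    and z: "z \<in> Obj K" "\<And>x. x \<in> Obj K \<Longrightarrow> \<exists>!f. f \<in> hom K z x"
  shows "aspherical W K"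
proof -
  interpret K: category K
    using K by (simp add: small_category_def)
  let ?E = "terminal_cat :: 'a cat"
  let ?F = "\<lparr>Source = ?E, Target = K, OMap = restrict (\<lambda>_. z) {undefined},
    AMap = restrict (\<lambda>_. Idt K z) {undefined}\<rparr>"
  have F: "is_functor ?F"
    using category_terminal_cat K.category_axioms z(1) K.Idt_hom[OF z(1)]
      K.Comp_Idt_left[OF K.Idt_hom[OF z(1)]]
    by (intro is_functor.intro) (auto simp: terminal_cat_def hom_def)
  have FC: "?F \<in> Cat_arrows"
    using F K small_category_terminal_cat by (simp add: Cat_arrows_def)
  \<comment> \<open>With \<open>h\<close> the unique arrow from \<open>z\<close> to
    \<open>x\<close>, the slice has one object, given by \<open>h\<close>, and one arrow.\<close>
  have tm: "has_terminal_object (slice_cat ?F x)" if x: "x \<in> Obj (Target ?F)" for x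
  proof -
    from x z(2) obtain h where h: "\<And>f. f \<in> hom K z x \<longleftrightarrow> f = h"
      by fastforce
    show ?thesis
      unfolding slice_cat_def Let_def
      by (rule homs_category.terminal_CH[OF slice_homs_category[OF F], where t = "opair undefined h"])
        (use h K.Comp_Idt_right[of h z x] in \<open>auto simp: terminal_cat_def hom_def\<close>)
  qed
  have "?F \<in> W"
    by (rule terminal_slices_in_localizer[OF W FC tm])
  moreover have "comp_functor (to_terminal K) ?F = to_terminal ?E"
    using comp_to_terminal[OF F] by simp
  moreover have "to_terminal ?E \<in> W"
    using W small_category_terminal_cat
    by (auto simp: weak_fundamental_localizer_def has_terminal_object_def terminal_cat_def hom_def)
  ultimately have "to_terminal K \<in> W"
    using weak_fundamental_localizer_2_of_3(2)[OF W FC to_terminal_Cat_arrows[OF K]]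
    by (simp add: to_terminal_def)
  then show ?thesis
    using K by (simp add: aspherical_def)
qed

section \<open>Factorizations of an arrow through a functor\<close>

text \<open>For \<open>g\<close> from u(a) to \<open>b\<close> this is the coslice of
  \<open>A/b\<close> under its object (a, g). The category \<open>K\<^sub>0\<close> is the case
  where \<open>b\<close> is w(b').\<close>

definition through_cat :: "'u::universe cfunctor \<Rightarrow> 'u \<Rightarrow> 'u \<Rightarrow> 'u \<Rightarrow> 'u cat" where
  "through_cat u a b g =
     cat_of_homs
       {otriple x f h | x f h. x \<in> Obj (Source u) \<and> f \<in> hom (Source u) a x \<and>
          h \<in> hom (Target u) (OMap u x) b \<and> Comp (Target u) h (AMap u f) = g}
       (\<lambda>x y. {p \<in> hom (Source u) (pr1 x) (pr1 y).
          Comp (Source u) p (pr1 (pr2 x)) = pr1 (pr2 y) \<and>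
          Comp (Target u) (pr2 (pr2 y)) (AMap u p) = pr2 (pr2 x)})
       (\<lambda>x. Idt (Source u) (pr1 x))
       (Comp (Source u))"

lemma through_homs_category:
  assumes "is_functor u"
  shows "homs_category
       {otriple x f h | x f h. x \<in> Obj (Source u) \<and> f \<in> hom (Source u) a x \<and>
          h \<in> hom (Target u) (OMap u x) b \<and> Comp (Target u) h (AMap u f) = g}
       (\<lambda>x y. {p \<in> hom (Source u) (pr1 x) (pr1 y).
          Comp (Source u) p (pr1 (pr2 x)) = pr1 (pr2 y) \<and>
          Comp (Target u) (pr2 (pr2 y)) (AMap u p) = pr2 (pr2 x)})
       (\<lambda>x. Idt (Source u) (pr1 x))
       (Comp (Source u))"
proof -
  interpret is_functor u by fact
  interpret A: category "Source u" by (rule Source_category)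
  interpret B: category "Target u" by (rule Target_category)
  show ?thesis
    by standard
      (auto simp: A.Idt_hom A.Comp_hom A.Comp_Idt_right A.Comp_Idt_left A.Comp_assoc
        AMap_Idt B.Comp_Idt_right AMap_Comp B.Comp_assoc[OF AMap_hom AMap_hom])
qed

lemma small_category_through_cat:
  assumes "u \<in> Cat_arrows"
  shows "small_category (through_cat u a b g)"
proof -
  have u: "is_functor u" "small_category (Source u)" "small_category (Target u)"
    using assms by (auto simp: Cat_arrows_def)
  have "small {otriple x f h | x f h. x \<in> Obj (Source u) \<and> f \<in> Arr (Source u) \<and> h \<in> Arr (Target u)}"
    using u by (simp add: small_category_def small_otriple)
  then have "small {otriple x f h | x f h. x \<in> Obj (Source u) \<and> f \<in> hom (Source u) a x \<and>
      h \<in> hom (Target u) (OMap u x) b \<and> Comp (Target u) h (AMap u f) = g}"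
    by (rule small_subset) (blast dest: hom_Arr)
  then show ?thesis
    unfolding through_cat_def
    by (rule homs_category.small_category_CH[OF through_homs_category[OF u(1)],
          where F = "Arr (Source u)"])
      (use u in \<open>auto simp: small_category_def dest: hom_Arr\<close>)
qed

text \<open>A coslice has an initial object, the identity of the object under which it is taken;
  here this is the factorization of \<open>g\<close> through the identity of
  \<open>a\<close>.\<close>

lemma aspherical_through_cat:
  assumes W: "weak_fundamental_localizer W" and uC: "u \<in> Cat_arrows"
    and a: "a \<in> Obj (Source u)" and g: "g \<in> hom (Target u) (OMap u a) b"
  shows "aspherical W (through_cat u a b g)"
proof -
  have u: "is_functor u"
    using uC by (simp add: Cat_arrows_def)
  interpret is_functor u by fact
  interpret A: category "Source u" by (rule Source_category)
  interpret B: category "Target u" by (rule Target_category)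
  let ?K = "through_cat u a b g" and ?z = "otriple a (Idt (Source u) a) g"
  note T = through_homs_category[OF u, of a b g]
  have z: "?z \<in> Obj ?K"
    using a g by (auto simp: through_cat_def homs_category.Obj_CH[OF T] otriple_eq_iff
        A.Idt_hom AMap_Idt B.Comp_Idt_right)
  show ?thesis
  proof (rule aspherical_initial_object[OF W small_category_through_cat[OF uC] z])
    fix x assume "x \<in> Obj ?K"
    then obtain y f h where x: "x = otriple y f h" "y \<in> Obj (Source u)" "f \<in> hom (Source u) a y"
        "h \<in> hom (Target u) (OMap u y) b" "Comp (Target u) h (AMap u f) = g"
      unfolding through_cat_def homs_category.Obj_CH[OF T] by blast
    \<comment> \<open>The condition p 1 = f already determines \<open>p\<close>. That
      \<open>f\<close> also meets the second condition is the equation h u(f) = g defining the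
      object \<open>x\<close>.\<close>
    have "p \<in> hom (Source u) a y \<and> Comp (Source u) p (Idt (Source u) a) = f \<and>
        Comp (Target u) h (AMap u p) = g \<longleftrightarrow> p = f" for p
    proof (cases "p \<in> hom (Source u) a y")
      case True
      show ?thesis
        unfolding A.Comp_Idt_right[OF True] using True x(5) by blast
    next
      case False
      then show ?thesis
        using x(3) by blast
    qed
    then have hom: "{p \<in> hom (Source u) a y. Comp (Source u) p (Idt (Source u) a) = f \<and>
        Comp (Target u) h (AMap u p) = g} = {f}"
      by blast
    have "z \<in> Obj ?K \<Longrightarrow> m \<in> hom ?K z x \<longleftrightarrow>
        (\<exists>p\<in>{p \<in> hom (Source u) (pr1 z) (pr1 x).
          Comp (Source u) p (pr1 (pr2 z)) = pr1 (pr2 x) \<and>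
          Comp (Target u) (pr2 (pr2 x)) (AMap u p) = pr2 (pr2 z)}. m = otriple z p x)" for m z
      using \<open>x \<in> Obj ?K\<close>
      unfolding through_cat_def homs_category.hom_CH[OF T] homs_category.Obj_CH[OF T] by blast
    note homK = this[OF z]
    have "m \<in> hom ?K ?z x \<longleftrightarrow> m \<in> {otriple ?z f x}" for m
      unfolding homK unfolding x(1) pr_otriple hom by (simp only: bex_simps singleton_iff simp_thms)
    then show "\<exists>!m. m \<in> hom ?K ?z x"
      by (intro ex1I[of _ "otriple ?z f x"]) (simp_all only: singleton_iff)
  qed
qed

section \<open>Comma squares\<close>

locale cat_square =
  fixes v w u' u :: "'u::universe cfunctor" and \<alpha> :: "'u \<Rightarrow> 'u"
  assumes square: "square v w u' u \<alpha>"
begin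

abbreviation "A' \<equiv> Source v"
abbreviation "A \<equiv> Source u"
abbreviation "B' \<equiv> Source w"
abbreviation "B \<equiv> Target u"

lemma Source_Target [simp]:
  "Source u' = A'" "Target v = A" "Target u' = B'" "Target w = B"
  using square by (auto simp: square_def)

lemma Cat_arrows_vwu:
  "v \<in> Cat_arrows" "w \<in> Cat_arrows" "u' \<in> Cat_arrows" "u \<in> Cat_arrows"
  using square by (auto simp: square_def)

sublocale V: is_functor v
  using Cat_arrows_vwu by (simp add: Cat_arrows_def)

sublocale W: is_functor w
  using Cat_arrows_vwu by (simp add: Cat_arrows_def)

sublocale U': is_functor u'
  using Cat_arrows_vwu by (simp add: Cat_arrows_def)

sublocale U: is_functor u
  using Cat_arrows_vwu by (simp add: Cat_arrows_def)

sublocale A': category A' by (rule V.Source_category)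
sublocale A: category A by (rule U.Source_category)
sublocale B': category B' by (rule W.Source_category)
sublocale B: category B by (rule U.Target_category)

lemma V_Obj [simp]: "x \<in> Obj A' \<Longrightarrow> OMap v x \<in> Obj A"
  using V.OMap_Obj by simp

lemma U'_Obj [simp]: "x \<in> Obj A' \<Longrightarrow> OMap u' x \<in> Obj B'"
  using U'.OMap_Obj by simp

lemma V_hom: "f \<in> hom A' x y \<Longrightarrow> AMap v f \<in> hom A (OMap v x) (OMap v y)"
  using V.AMap_hom by simp

lemma U'_hom: "f \<in> hom A' x y \<Longrightarrow> AMap u' f \<in> hom B' (OMap u' x) (OMap u' y)"
  using U'.AMap_hom by simp

lemma W_hom: "f \<in> hom B' x y \<Longrightarrow> AMap w f \<in> hom B (OMap w x) (OMap w y)"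
  using W.AMap_hom by simp

lemma \<alpha>_hom: "x \<in> Obj A' \<Longrightarrow> \<alpha> x \<in> hom B (OMap u (OMap v x)) (OMap w (OMap u' x))"
  using square nat_trans.component_hom[of "comp_functor u v" "comp_functor w u'" \<alpha> x]
  by (auto simp: square_def comp_functor_def compose_def)

lemma \<alpha>_natural:
  assumes "f \<in> hom A' x y"
  shows "Comp B (\<alpha> y) (AMap u (AMap v f)) = Comp B (AMap w (AMap u' f)) (\<alpha> x)"
  using assms square nat_trans.naturality[of "comp_functor u v" "comp_functor w u'" \<alpha> f x y]
  by (auto simp: square_def comp_functor_def compose_def hom_Arr)

section \<open>The factorization category of a square and its functor to
  \<open>K\<^sub>0\<close>\<close>

lemma factorization_homs_category:
  "homs_category
       {otriple a' f g' | a' f g'.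
          a' \<in> Obj A' \<and> f \<in> hom A a (OMap v a') \<and> g' \<in> hom B' (OMap u' a') b' \<and>
          Comp B (AMap w g') (Comp B (\<alpha> a') (AMap u f)) = g}
       (\<lambda>x y. {f' \<in> hom A' (pr1 x) (pr1 y).
          Comp A (AMap v f') (pr1 (pr2 x)) = pr1 (pr2 y) \<and>
          Comp B' (pr2 (pr2 y)) (AMap u' f') = pr2 (pr2 x)})
       (\<lambda>x. Idt A' (pr1 x))
       (Comp A')"
proof -
  have V_Comp: "AMap v (Comp A' g f) = Comp A (AMap v g) (AMap v f)"
    if "f \<in> hom A' x y" "g \<in> hom A' y z" for x y z f g
    using V.AMap_Comp that by simp
  have U'_Comp: "AMap u' (Comp A' g f) = Comp B' (AMap u' g) (AMap u' f)"
    if "f \<in> hom A' x y" "g \<in> hom A' y z" for x y z f g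
    using U'.AMap_Comp[of f x y g z] that by simp
  show ?thesis
    using V.AMap_Idt U'.AMap_Idt
    by (intro homs_category.intro)
      (auto simp: A'.Idt_hom A'.Comp_hom A'.Comp_Idt_right A'.Comp_Idt_left A'.Comp_assoc
        V_Comp U'_Comp A.Comp_Idt_left B'.Comp_Idt_right B'.Comp_assoc[OF U'_hom U'_hom]
        A.Comp_assoc[OF _ V_hom V_hom])
qed

lemma small_category_factorization_cat:
  "small_category (factorization_cat v w u' u \<alpha> a b' g)"
proof -
  have s: "small (Obj A')" "small (Arr A')" "small (Arr A)" "small (Arr B')"
    using Cat_arrows_vwu by (auto simp: Cat_arrows_def small_category_def)
  have "small {otriple a' f g' | a' f g'. a' \<in> Obj A' \<and> f \<in> Arr A \<and> g' \<in> Arr B'}"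
    using s by (simp add: small_otriple)
  then have "small {otriple a' f g' | a' f g'.
          a' \<in> Obj A' \<and> f \<in> hom A a (OMap v a') \<and> g' \<in> hom B' (OMap u' a') b' \<and>
          Comp B (AMap w g') (Comp B (\<alpha> a') (AMap u f)) = g}"
    by (rule small_subset) (blast dest: hom_Arr)
  then show ?thesis
    unfolding factorization_cat_def Let_def
    by (rule homs_category.small_category_CH[OF factorization_homs_category _ s(2)])
      (auto dest: hom_Arr)
qed

text \<open>The name anticipates \<open>terminal_slice_reflection\<close>: in a comma square, for
  \<open>b'\<close> an object of \<open>B'\<close>, this functor has a right adjoint with identity
  counit, so \<open>K\<^sub>0\<close> is reflective in the factorization category.\<close>

definition reflection :: "'u \<Rightarrow> 'u \<Rightarrow> 'u \<Rightarrow> 'u cfunctor" where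
  "reflection a b' g =
     functor_of_homs (factorization_cat v w u' u \<alpha> a b' g) (through_cat u a (OMap w b') g)
       (\<lambda>x. otriple (OMap v (pr1 x)) (pr1 (pr2 x))
         (Comp B (AMap w (pr2 (pr2 x))) (\<alpha> (pr1 x))))
       (AMap v)"

lemma is_functor_reflection: "is_functor (reflection a b' g)"
proof -
  \<comment> \<open>Compatibility of v(f) with the second legs in \<open>K\<^sub>0\<close> is
    naturality of \<alpha> at \<open>f\<close>, composed with w(k).\<close>
  have *: "Comp B (Comp B (AMap w k) (\<alpha> y)) (AMap u (AMap v f)) =
      Comp B (AMap w (Comp B' k (AMap u' f))) (\<alpha> x)"
    if "x \<in> Obj A'" "y \<in> Obj A'" "f \<in> hom A' x y" "k \<in> hom B' (OMap u' y) b'" for x y f k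
  proof -
    note f = U.AMap_hom[OF V_hom[OF that(3)]] W_hom[OF U'_hom[OF that(3)]]
    note k = W_hom[OF that(4)]
    have "Comp B (Comp B (AMap w k) (\<alpha> y)) (AMap u (AMap v f))
        = Comp B (AMap w k) (Comp B (AMap w (AMap u' f)) (\<alpha> x))"
      using that by (simp add: B.Comp_assoc[OF f(1) \<alpha>_hom k, symmetric] \<alpha>_natural)
    also have "\<dots> = Comp B (AMap w (Comp B' k (AMap u' f))) (\<alpha> x)"
      using that W.AMap_Comp[OF U'_hom[OF that(3)] that(4)]
      by (simp add: B.Comp_assoc[OF \<alpha>_hom f(2) k])
    finally show ?thesis .
  qed
  show ?thesis
    unfolding reflection_def factorization_cat_def through_cat_def Let_def
    by (rule is_functor_functor_of_homs[OF factorization_homs_category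
          through_homs_category[OF U.is_functor_axioms]])
      (use V.AMap_Idt V.AMap_Comp in \<open>auto simp: otriple_eq_iff B.Comp_hom[OF \<alpha>_hom W_hom] V_hom *
        B.Comp_assoc[OF U.AMap_hom \<alpha>_hom W_hom]\<close>)
qed

lemma reflection_Cat_arrows: "reflection a b' g \<in> Cat_arrows"
  using is_functor_reflection small_category_factorization_cat
    small_category_through_cat[OF Cat_arrows_vwu(4)]
  by (simp add: Cat_arrows_def) (simp add: reflection_def)

section \<open>The comma category of \<open>u\<close> and \<open>w\<close>\<close>

lemma comma_homs_category:
  "homs_category
       {otriple a b' g | a b' g. a \<in> Obj A \<and> b' \<in> Obj B' \<and> g \<in> hom B (OMap u a) (OMap w b')}
       (\<lambda>x y. {opair f g' | f g'.
          f \<in> hom A (pr1 x) (pr1 y) \<and> g' \<in> hom B' (pr1 (pr2 x)) (pr1 (pr2 y)) \<and>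
          Comp B (pr2 (pr2 y)) (AMap u f) = Comp B (AMap w g') (pr2 (pr2 x))})
       (\<lambda>x. opair (Idt A (pr1 x)) (Idt B' (pr1 (pr2 x))))
       (\<lambda>q p. opair (Comp A (pr1 q) (pr1 p)) (Comp B' (pr2 q) (pr2 p)))"
proof -
  \<comment> \<open>Pasting of two adjacent commutative squares: composites of morphisms of the
    comma category are again morphisms.\<close>
  have *: "Comp B h\<^sub>3 (AMap u (Comp A f\<^sub>2 f\<^sub>1)) = Comp B (AMap w (Comp B' g\<^sub>2 g\<^sub>1)) h\<^sub>1"
    if "f\<^sub>1 \<in> hom A a\<^sub>1 a\<^sub>2" "f\<^sub>2 \<in> hom A a\<^sub>2 a\<^sub>3" "g\<^sub>1 \<in> hom B' b\<^sub>1 b\<^sub>2" "g\<^sub>2 \<in> hom B' b\<^sub>2 b\<^sub>3"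
      "h\<^sub>1 \<in> hom B (OMap u a\<^sub>1) (OMap w b\<^sub>1)" "h\<^sub>2 \<in> hom B (OMap u a\<^sub>2) (OMap w b\<^sub>2)"
      "h\<^sub>3 \<in> hom B (OMap u a\<^sub>3) (OMap w b\<^sub>3)"
      "Comp B h\<^sub>2 (AMap u f\<^sub>1) = Comp B (AMap w g\<^sub>1) h\<^sub>1"
      "Comp B h\<^sub>3 (AMap u f\<^sub>2) = Comp B (AMap w g\<^sub>2) h\<^sub>2"
    for a\<^sub>1 a\<^sub>2 a\<^sub>3 b\<^sub>1 b\<^sub>2 b\<^sub>3 f\<^sub>1 f\<^sub>2 g\<^sub>1 g\<^sub>2 h\<^sub>1 h\<^sub>2 h\<^sub>3
  proof -
    note U = U.AMap_hom[OF that(1)] U.AMap_hom[OF that(2)]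
    note W = W_hom[OF that(3)] W_hom[OF that(4)]
    have "Comp B h\<^sub>3 (AMap u (Comp A f\<^sub>2 f\<^sub>1)) = Comp B (Comp B (AMap w g\<^sub>2) h\<^sub>2) (AMap u f\<^sub>1)"
      using that by (simp add: U.AMap_Comp[OF that(1,2)] B.Comp_assoc[OF U that(7)])
    also have "\<dots> = Comp B (AMap w g\<^sub>2) (Comp B (AMap w g\<^sub>1) h\<^sub>1)"
      using that by (simp add: B.Comp_assoc[OF U(1) that(6) W(2), symmetric])
    also have "\<dots> = Comp B (AMap w (Comp B' g\<^sub>2 g\<^sub>1)) h\<^sub>1"
      using W.AMap_Comp[OF that(3,4)] by (simp add: B.Comp_assoc[OF that(5) W])
    finally show ?thesis .
  qed
  show ?thesis
    using W.AMap_Idt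
    by unfold_locales
      (auto simp: A.Idt_hom A.Comp_hom A.Comp_Idt_right A.Comp_Idt_left A.Comp_assoc
        B'.Idt_hom B'.Comp_hom B'.Comp_Idt_right B'.Comp_Idt_left B'.Comp_assoc
        U.AMap_Idt B.Comp_Idt_right B.Comp_Idt_left opair_eq_iff *)
qed

end

section \<open>Lifting objects and arrows through the comparison isomorphism\<close>

locale comma_sq = cat_square +
  assumes iso: "is_iso_functor (comma_comparison v w u' u \<alpha>)"
begin

abbreviation "F \<equiv> comma_comparison v w u' u \<alpha>"

lemma F_sel:
  "Source F = A'" "Target F = comma_cat u w"
  "x \<in> Obj A' \<Longrightarrow> OMap F x = otriple (OMap v x) (OMap u' x) (\<alpha> x)"
  "f \<in> hom A' x y \<Longrightarrow> x \<in> Obj A' \<Longrightarrow> y \<in> Obj A' \<Longrightarrow>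
    AMap F f = otriple (OMap F x) (opair (AMap v f) (AMap u' f)) (OMap F y)"
  by (auto simp: comma_comparison_def Let_def hom_def)

text \<open>The isomorphism is given by equations between restricted functions; evaluating them on
  their domains yields pointwise inverses.\<close>

lemma comma_inverse:
  obtains G where "is_functor G" "Source G = comma_cat u w" "Target G = A'"
    "\<And>x. x \<in> Obj A' \<Longrightarrow> OMap G (OMap F x) = x"
    "\<And>f. f \<in> Arr A' \<Longrightarrow> AMap G (AMap F f) = f"
    "\<And>x. x \<in> Obj (comma_cat u w) \<Longrightarrow> OMap F (OMap G x) = x"
    "\<And>f. f \<in> Arr (comma_cat u w) \<Longrightarrow> AMap F (AMap G f) = f"
proof -
  obtain G where G: "is_functor G" "Source G = Target F" "Target G = Source F"
    "comp_functor G F = id_functor (Source F)" "comp_functor F G = id_functor (Target F)"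
    using iso unfolding is_iso_functor_def by blast
  have GF: "compose (Obj A') (OMap G) (OMap F) = restrict (\<lambda>x. x) (Obj A')"
    "compose (Arr A') (AMap G) (AMap F) = restrict (\<lambda>x. x) (Arr A')"
    using G(4) by (simp_all add: comp_functor_def id_functor_def F_sel)
  have FG: "compose (Obj (comma_cat u w)) (OMap F) (OMap G) = restrict (\<lambda>x. x) (Obj (comma_cat u w))"
    "compose (Arr (comma_cat u w)) (AMap F) (AMap G) = restrict (\<lambda>x. x) (Arr (comma_cat u w))"
    using G(2,5) by (simp_all add: comp_functor_def id_functor_def F_sel)
  show thesis
  proof (rule that[OF G(1)])
    show "OMap G (OMap F x) = x" if "x \<in> Obj A'" for x
      using fun_cong[OF GF(1), of x] that by (simp add: compose_def)
    show "AMap G (AMap F f) = f" if "f \<in> Arr A'" for f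
      using fun_cong[OF GF(2), of f] that by (simp add: compose_def)
    show "OMap F (OMap G x) = x" if "x \<in> Obj (comma_cat u w)" for x
      using fun_cong[OF FG(1), of x] that by (simp add: compose_def)
    show "AMap F (AMap G f) = f" if "f \<in> Arr (comma_cat u w)" for f
      using fun_cong[OF FG(2), of f] that by (simp add: compose_def)
  qed (use G F_sel in auto)
qed

text \<open>Surjectivity of the comparison on objects. It supplies, inside \<open>A'\<close>, the
  object written as a triple in the formula for the right adjoint.\<close>

lemma object_lift:
  assumes "a \<in> Obj A" "b' \<in> Obj B'" "h \<in> hom B (OMap u a) (OMap w b')"
  obtains x where "x \<in> Obj A'" "OMap v x = a" "OMap u' x = b'" "\<alpha> x = h"
proof -
  obtain G where G: "is_functor G" "Source G = comma_cat u w" "Target G = A'"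
    "\<And>x. x \<in> Obj (comma_cat u w) \<Longrightarrow> OMap F (OMap G x) = x"
    by (rule comma_inverse) blast
  let ?x = "otriple a b' h"
  have x: "?x \<in> Obj (comma_cat u w)"
    using assms by (auto simp: comma_cat_def Let_def homs_category.Obj_CH[OF comma_homs_category])
  have "OMap G ?x \<in> Obj A'"
    using is_functor.OMap_Obj[OF G(1)] x G(2,3) by simp
  then show thesis
    using G(4)[OF x] that by (simp add: F_sel otriple_eq_iff)
qed

text \<open>The comparison is fully faithful, and the last hypothesis says that (p, q) is an arrow
  between the images of \<open>x\<close> and \<open>y\<close> in the comma category.\<close>

lemma arrow_lift:
  assumes "x \<in> Obj A'" "y \<in> Obj A'"
    and "p \<in> hom A (OMap v x) (OMap v y)" "q \<in> hom B' (OMap u' x) (OMap u' y)"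
    and "Comp B (\<alpha> y) (AMap u p) = Comp B (AMap w q) (\<alpha> x)"
  shows "\<exists>!f. f \<in> hom A' x y \<and> AMap v f = p \<and> AMap u' f = q"
proof -
  obtain G where G: "is_functor G" "Source G = comma_cat u w" "Target G = A'"
    "\<And>x. x \<in> Obj A' \<Longrightarrow> OMap G (OMap F x) = x"
    "\<And>f. f \<in> Arr A' \<Longrightarrow> AMap G (AMap F f) = f"
    "\<And>f. f \<in> Arr (comma_cat u w) \<Longrightarrow> AMap F (AMap G f) = f"
    by (rule comma_inverse) blast
  let ?m = "otriple (OMap F x) (opair p q) (OMap F y)"
  have m: "?m \<in> hom (comma_cat u w) (OMap F x) (OMap F y)"
    using assms \<alpha>_hom
    by (auto simp: comma_cat_def Let_def homs_category.hom_CH[OF comma_homs_category] F_sel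
        otriple_eq_iff opair_eq_iff)
  have Gm: "AMap G ?m \<in> hom A' x y"
    using is_functor.AMap_hom[OF G(1)] m assms G(2-4) by metis
  have "AMap F (AMap G ?m) = ?m"
    using m by (intro G(6) hom_Arr)
  then have lift: "AMap v (AMap G ?m) = p" "AMap u' (AMap G ?m) = q"
    using F_sel(4)[OF Gm assms(1,2)] by (simp_all add: otriple_eq_iff opair_eq_iff)
  \<comment> \<open>Such an \<open>f\<close> has image \<open>?m\<close> under \<open>F\<close>, and
    \<open>G\<close> undoes \<open>F\<close>.\<close>
  have "f = AMap G ?m" if "f \<in> hom A' x y" "AMap v f = p" "AMap u' f = q" for f
    using G(5)[OF hom_Arr[OF that(1)]] F_sel(4)[OF that(1) assms(1,2)] that by simp
  then show ?thesis
    by (intro ex1I[of _ "AMap G ?m"] conjI Gm lift) (elim conjE)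
qed

text \<open>Write k = (y, f, h). The terminal object consists of ((y, b', h), f, 1) and the identity
  of \<open>k\<close>. For x = (a', f', g'), an arrow from the image of \<open>x\<close> to
  \<open>k\<close> is a \<open>q\<close> with q f' = f and h u(q) = w(g') \<alpha>. The second
  equation makes (q, g') an arrow of the comma category, and its unique lift to \<open>A'\<close> is
  the required morphism.\<close>

lemma terminal_slice_reflection:
  assumes b': "b' \<in> Obj B'" and k: "k \<in> Obj (through_cat u a (OMap w b') g)"
  shows "has_terminal_object (slice_cat (reflection a b' g) k)"
proof -
  let ?R = "reflection a b' g" and ?K = "factorization_cat v w u' u \<alpha> a b' g"
    and ?K\<^sub>0 = "through_cat u a (OMap w b') g"
  note T = through_homs_category[OF U.is_functor_axioms, of a "OMap w b'" g]
  note K = factorization_homs_category[of a b' g]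
  note S = slice_homs_category[OF is_functor_reflection, of a b' g k]
  interpret K\<^sub>0: category ?K\<^sub>0
    unfolding through_cat_def by (rule homs_category.category_CH[OF T])
  interpret R: is_functor ?R
    by (rule is_functor_reflection)
  have sel: "Source ?R = ?K" "Target ?R = ?K\<^sub>0"
    by (simp_all only: reflection_def functor_of_homs_sel)
  have OMap_R: "OMap ?R x = otriple (OMap v (pr1 x)) (pr1 (pr2 x))
      (Comp B (AMap w (pr2 (pr2 x))) (\<alpha> (pr1 x)))" if "x \<in> Obj ?K" for x
    using that by (simp add: reflection_def)
  have AMap_R: "AMap ?R (otriple x s y) = otriple (OMap ?R x) (AMap v s) (OMap ?R y)"
    if "otriple x s y \<in> hom ?K x y" "x \<in> Obj ?K" "y \<in> Obj ?K" for x s y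
    using that by (simp add: reflection_def functor_of_homs_def hom_Arr)
  obtain y f h where k_eq: "k = otriple y f h" and y: "y \<in> Obj A" and f: "f \<in> hom A a y"
    and h: "h \<in> hom B (OMap u y) (OMap w b')" "Comp B h (AMap u f) = g"
    using k unfolding through_cat_def homs_category.Obj_CH[OF T] by blast
  obtain x\<^sub>0 where x\<^sub>0: "x\<^sub>0 \<in> Obj A'" "OMap v x\<^sub>0 = y" "OMap u' x\<^sub>0 = b'" "\<alpha> x\<^sub>0 = h"
    using object_lift[OF y b' h(1)] .
  let ?t = "otriple x\<^sub>0 f (Idt B' b')"
  have w_Idt: "Comp B (AMap w (Idt B' b')) j = j" if "j \<in> hom B z (OMap w b')" for z j
    using W.AMap_Idt[OF b'] B.Comp_Idt_left[OF that] by simp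
  have "Comp B (AMap w (Idt B' b')) (Comp B (\<alpha> x\<^sub>0) (AMap u f)) = g"
    unfolding x\<^sub>0(4) w_Idt[OF B.Comp_hom[OF U.AMap_hom[OF f] h(1)]] by (rule h(2))
  then have t: "?t \<in> Obj ?K"
    unfolding factorization_cat_def Let_def homs_category.Obj_CH[OF K]
    using x\<^sub>0(1) f B'.Idt_hom[OF b'] unfolding x\<^sub>0(2,3)[symmetric] by blast
  \<comment> \<open>Since w preserves the identity of \<open>b'\<close>, the image of
    \<open>?t\<close> is \<open>k\<close> on the nose, so the identity of \<open>k\<close> can serve
    as counit.\<close>
  have Rt: "OMap ?R ?t = k"
    unfolding OMap_R[OF t] pr_otriple x\<^sub>0(2,4) k_eq w_Idt[OF h(1)] ..
  have "Idt ?K\<^sub>0 k \<in> hom ?K\<^sub>0 (OMap ?R ?t) k"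
    unfolding Rt by (rule K\<^sub>0.Idt_hom[OF k])
  with t have t': "opair ?t (Idt ?K\<^sub>0 k) \<in> {opair a m | a m.
      a \<in> Obj (Source ?R) \<and> m \<in> hom (Target ?R) (OMap ?R a) k}"
    unfolding sel by blast
  have unique: "\<exists>!m. m \<in> hom ?K x ?t \<and> Comp ?K\<^sub>0 (Idt ?K\<^sub>0 k) (AMap ?R m) = n"
    if x: "x \<in> Obj ?K" and n: "n \<in> hom ?K\<^sub>0 (OMap ?R x) k" for x n
  proof -
    obtain a' f' g' where x_eq: "x = otriple a' f' g'" and a': "a' \<in> Obj A'"
      and g': "g' \<in> hom B' (OMap u' a') b'"
      using x unfolding factorization_cat_def Let_def homs_category.Obj_CH[OF K] by blast
    have Rx: "OMap ?R x = otriple (OMap v a') f' (Comp B (AMap w g') (\<alpha> a'))"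
      unfolding OMap_R[OF x] unfolding x_eq pr_otriple ..
    obtain q where n_eq: "n = otriple (OMap ?R x) q k" and q: "q \<in> hom A (OMap v a') y"
      "Comp A q f' = f" "Comp B h (AMap u q) = Comp B (AMap w g') (\<alpha> a')"
      using n unfolding through_cat_def homs_category.hom_CH[OF T]
      unfolding through_cat_def[symmetric] Rx k_eq pr_otriple by blast
    \<comment> \<open>The third component of \<open>?t\<close> is an identity, so the condition on
      u'(s) prescribes its value \<open>g'\<close>.\<close>
    have hom_K: "m \<in> hom ?K x ?t \<longleftrightarrow> (\<exists>s. m = otriple x s ?t \<and> s \<in> hom A' a' x\<^sub>0 \<and>
        Comp A (AMap v s) f' = f \<and> AMap u' s = g')" for m
    proof -
      have "m \<in> hom ?K x ?t \<longleftrightarrow> (\<exists>s. m = otriple x s ?t \<and> s \<in> hom A' a' x\<^sub>0 \<and>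
          Comp A (AMap v s) f' = f \<and> Comp B' (Idt B' b') (AMap u' s) = g')"
        using x t unfolding factorization_cat_def Let_def homs_category.hom_CH[OF K]
          homs_category.Obj_CH[OF K]
        unfolding x_eq pr_otriple by blast
      moreover have "Comp B' (Idt B' b') (AMap u' s) = AMap u' s" if "s \<in> hom A' a' x\<^sub>0" for s
        using B'.Comp_Idt_left U'_hom[OF that] unfolding x\<^sub>0(3) by blast
      ultimately show ?thesis
        by metis
    qed
    \<comment> \<open>With an identity as counit, the triangle over \<open>k\<close> says that the
      image of \<open>m\<close> is \<open>n\<close>; comparing untagged arrows leaves v(s) =
      q.\<close>
    have comp: "Comp ?K\<^sub>0 (Idt ?K\<^sub>0 k) (AMap ?R m) = n \<longleftrightarrow> AMap v s = q"
      if m: "m \<in> hom ?K x ?t" "m = otriple x s ?t" for m s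
    proof -
      have "AMap ?R m \<in> hom ?K\<^sub>0 (OMap ?R x) k"
        using R.AMap_hom[unfolded sel, OF m(1)] unfolding Rt .
      then have "Comp ?K\<^sub>0 (Idt ?K\<^sub>0 k) (AMap ?R m) = AMap ?R m"
        by (rule K\<^sub>0.Comp_Idt_left)
      also have "\<dots> = otriple (OMap ?R x) (AMap v s) k"
        using AMap_R[OF m(1)[unfolded m(2)] x t] unfolding m(2) Rt .
      finally show ?thesis
        by (simp only: n_eq otriple_eq_iff simp_thms)
    qed
    \<comment> \<open>Rewritten along \<open>x\<^sub>0\<close>, the hypotheses of the lift are the
      types of \<open>q\<close> and \<open>g'\<close> and the equation h u(q) = w(g')
      \<alpha>.\<close>
    have "\<exists>!s. s \<in> hom A' a' x\<^sub>0 \<and> AMap v s = q \<and> AMap u' s = g'"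
      by (rule arrow_lift[OF a' x\<^sub>0(1)]) (unfold x\<^sub>0, fact+)
    then obtain s where s: "s \<in> hom A' a' x\<^sub>0 \<and> AMap v s = q \<and> AMap u' s = g'"
      and uniq: "\<And>s'. s' \<in> hom A' a' x\<^sub>0 \<and> AMap v s' = q \<and> AMap u' s' = g' \<Longrightarrow> s' = s"
      by (elim ex1E) blast
    have sK: "otriple x s ?t \<in> hom ?K x ?t"
      unfolding hom_K using s q(2) by blast
    show ?thesis
    proof (rule ex1I)
      show "otriple x s ?t \<in> hom ?K x ?t \<and> Comp ?K\<^sub>0 (Idt ?K\<^sub>0 k) (AMap ?R (otriple x s ?t)) = n"
        using sK s comp[OF sK refl] by blast
    next
      fix m assume m: "m \<in> hom ?K x ?t \<and> Comp ?K\<^sub>0 (Idt ?K\<^sub>0 k) (AMap ?R m) = n"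
      then obtain s' where s': "m = otriple x s' ?t" "s' \<in> hom A' a' x\<^sub>0" "AMap u' s' = g'"
        unfolding hom_K by blast
      then have "AMap v s' = q"
        using comp[of m s'] m by blast
      then show "m = otriple x s ?t"
        using uniq[of s'] s' by blast
    qed
  qed
  show ?thesis
    unfolding slice_cat_def Let_def
  proof (rule homs_category.terminal_CH[OF S t'])
    fix z assume "z \<in> {opair a m | a m. a \<in> Obj (Source ?R) \<and> m \<in> hom (Target ?R) (OMap ?R a) k}"
    then obtain x n where z: "z = opair x n" and x: "x \<in> Obj ?K" "n \<in> hom ?K\<^sub>0 (OMap ?R x) k"
      unfolding sel by blast
    show "\<exists>!m. m \<in> {m \<in> hom (Source ?R) (pr1 z) (pr1 (opair ?t (Idt ?K\<^sub>0 k))).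
        Comp (Target ?R) (pr2 (opair ?t (Idt ?K\<^sub>0 k))) (AMap ?R m) = pr2 z}"
      unfolding z pr_opair sel mem_Collect_eq by (rule unique[OF x])
  qed
qed

lemma aspherical_factorization_cat:
  assumes W: "weak_fundamental_localizer W"
    and a: "a \<in> Obj A" and b': "b' \<in> Obj B'" and g: "g \<in> hom B (OMap u a) (OMap w b')"
  shows "aspherical W (factorization_cat v w u' u \<alpha> a b' g)"
proof -
  let ?R = "reflection a b' g"
  have sel: "Source ?R = factorization_cat v w u' u \<alpha> a b' g"
    "Target ?R = through_cat u a (OMap w b') g"
    by (simp_all add: reflection_def)
  have R: "?R \<in> W"
    by (rule terminal_slices_in_localizer[OF W reflection_Cat_arrows])
      (rule terminal_slice_reflection[OF b'], simp only: sel)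
  have K: "small_category (Target ?R)" "to_terminal (Target ?R) \<in> W"
    using aspherical_through_cat[OF W Cat_arrows_vwu(4) a g] by (simp_all only: aspherical_def sel)
  \<comment> \<open>The functor from the factorization category to \<open>e\<close> factors through
    \<open>K\<^sub>0\<close>, with both factors in \<open>W\<close>.\<close>
  have "comp_functor (to_terminal (Target ?R)) ?R \<in> W"
    by (rule weak_fundamental_localizer_2_of_3(1)[OF W reflection_Cat_arrows
          to_terminal_Cat_arrows[OF K(1)] _ R K(2)])
      (simp only: to_terminal_def cfunctor.simps)
  then show ?thesis
    unfolding comp_to_terminal[OF is_functor_reflection refl]
    by (simp add: aspherical_def sel small_category_factorization_cat)
qed

end

theorem proposition2p10:
  fixes W :: "'u::universe cfunctor set"
    and v w u' u :: "'u cfunctor" and \<alpha> :: "'u \<Rightarrow> 'u"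
  assumes "weak_fundamental_localizer W"
    and "comma_square v w u' u \<alpha>"
  shows "exact_square W v w u' u \<alpha>"
proof -
  interpret comma_sq v w u' u \<alpha>
    using assms(2) by unfold_locales (simp_all add: comma_square_def)
  show ?thesis
    unfolding exact_square_def
    using square aspherical_factorization_cat[OF assms(1)] by blast
qed

end
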